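(* Let $(L,\ast_1,\ast_2,\delta_1,\delta_2)$ be a compatible zinDer pair. For $i\in\{1,2\}$ define bilinear maps $\mu_i:L\times L\to L$ by $$\mu_i(x,y)=x\ast_iy+y\ast_ix,\qquad x,y\in L.$$ Then $(L,\mu_1,\mu_2,\delta_1,\delta_2)$ is a compatible AssDer pair.
   Context: All vector spaces are over a field $\mathbb{K}$ of characteristic $0$. A zinbiel algebra $(L,\ast)$ is a vector space with a bilinear operation such that $x\ast(y\ast z)=(x\ast y)\ast z+(y\ast x)\ast z$. A zinDer pair $(L,\ast,\delta)$ is a zinbiel algebra with a linear map $\delta:L\to L$ such that $\delta(x\ast y)=\delta x\ast y+x\ast\delta y$. A compatible zinDer pair (compatible zinbiel Der pair) $(L,\ast_1,\ast_2,\delta_1,\delta_2)$ consists of two zinDer pairs $(L,\ast_1,\delta_1)$, $(L,\ast_2,\delta_2)$ such that for all $x,y,z\in L$: $x\ast_1(y\ast_2z)+x\ast_2(y\ast_1z)=(x\ast_2y)\ast_1z+(x\ast_1y)\ast_2z+(y\ast_2x)\ast_1z+(y\ast_1x)\ast_2z$ and $\delta_1(x\ast_2y)+\delta_2(x\ast_1y)=\delta_1x\ast_2y+x\ast_2\delta_1y+\delta_2x\ast_1y+x\ast_1\delta_2y$. An AssDer pair $(L,\mu,\delta)$ is an associative algebra $(L,\mu)$ with a derivation $\delta$. A compatible AssDer pair $(L,\mu_1,\mu_2,\delta_1,\delta_2)$ consists of two AssDer pairs $(L,\mu_1,\delta_1)$, $(L,\mu_2,\delta_2)$ such that for all $x,y,z\in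 L$: $\mu_2(\mu_1(x,y),z)+\mu_1(\mu_2(x,y),z)=\mu_1(x,\mu_2(y,z))+\mu_2(x,\mu_1(y,z))$ and $\delta_1(\mu_2(x,y))+\delta_2(\mu_1(x,y))=\mu_2(\delta_1x,y)+\mu_2(x,\delta_1y)+\mu_1(\delta_2x,y)+\mu_1(x,\delta_2y)$. *)

theory Defs
  imports Complex_Main
begin

definition bilinear_op ::
    "('k::field \<Rightarrow> 'v::ab_group_add \<Rightarrow> 'v) \<Rightarrow> ('v \<Rightarrow> 'v \<Rightarrow> 'v) \<Rightarrow> bool" where
  "bilinear_op scale m \<longleftrightarrow>
     (\<forall>x. Vector_Spaces.linear scale scale (\<lambda>y. m x y)) \<and>
     (\<forall>y. Vector_Spaces.linear scale scale (\<lambda>x. m x y))"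

definition derivation ::
    "('k::field \<Rightarrow> 'v::ab_group_add \<Rightarrow> 'v) \<Rightarrow> ('v \<Rightarrow> 'v \<Rightarrow> 'v) \<Rightarrow> ('v \<Rightarrow> 'v) \<Rightarrow> bool" where
  "derivation scale m d \<longleftrightarrow>
     Vector_Spaces.linear scale scale d \<and> (\<forall>x y. d (m x y) = m (d x) y + m x (d y))"

locale zinbiel_algebra = vector_space scale
  for scale :: "'k::field_char_0 \<Rightarrow> 'v::ab_group_add \<Rightarrow> 'v" +
  fixes ast :: "'v \<Rightarrow> 'v \<Rightarrow> 'v"
  assumes bilinear: "bilinear_op scale ast"
    and zinbiel: "ast x (ast y z) = ast (ast x y) z + ast (ast y x) z"

locale zinDer_pair = zinbiel_algebra scale ast
  for scale :: "'k::field_char_0 \<Rightarrow> 'v::ab_group_add \<Rightarrow> 'v" and ast +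
  fixes \<delta> :: "'v \<Rightarrow> 'v"
  assumes derivation: "derivation scale ast \<delta>"

locale compatible_zinDer_pair =
  Z1: zinDer_pair scale ast1 \<delta>1 + Z2: zinDer_pair scale ast2 \<delta>2
  for scale :: "'k::field_char_0 \<Rightarrow> 'v::ab_group_add \<Rightarrow> 'v"
    and ast1 ast2 \<delta>1 \<delta>2 +
  assumes zinbiel_compat:
      "ast1 x (ast2 y z) + ast2 x (ast1 y z) =
       ast1 (ast2 x y) z + ast2 (ast1 x y) z + ast1 (ast2 y x) z + ast2 (ast1 y x) z"
    and derivation_compat:
      "\<delta>1 (ast2 x y) + \<delta>2 (ast1 x y) =
       ast2 (\<delta>1 x) y + ast2 x (\<delta>1 y) + ast1 (\<delta>2 x) y + ast1 x (\<delta>2 y)"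

text \<open>Associative algebras are not assumed to be unital.\<close>

locale assoc_algebra = vector_space scale
  for scale :: "'k::field_char_0 \<Rightarrow> 'v::ab_group_add \<Rightarrow> 'v" +
  fixes \<mu> :: "'v \<Rightarrow> 'v \<Rightarrow> 'v"
  assumes bilinear: "bilinear_op scale \<mu>"
    and assoc: "\<mu> (\<mu> x y) z = \<mu> x (\<mu> y z)"

locale AssDer_pair = assoc_algebra scale \<mu>
  for scale :: "'k::field_char_0 \<Rightarrow> 'v::ab_group_add \<Rightarrow> 'v" and \<mu> +
  fixes \<delta> :: "'v \<Rightarrow> 'v"
  assumes derivation: "derivation scale \<mu> \<delta>"

locale compatible_AssDer_pair =
  A1: AssDer_pair scale \<mu>1 \<delta>1 + A2: AssDer_pair scale \<mu>2 \<delta>2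
  for scale :: "'k::field_char_0 \<Rightarrow> 'v::ab_group_add \<Rightarrow> 'v"
    and \<mu>1 \<mu>2 \<delta>1 \<delta>2 +
  assumes assoc_compat:
      "\<mu>2 (\<mu>1 x y) z + \<mu>1 (\<mu>2 x y) z = \<mu>1 x (\<mu>2 y z) + \<mu>2 x (\<mu>1 y z)"
    and derivation_compat:
      "\<delta>1 (\<mu>2 x y) + \<delta>2 (\<mu>1 x y) =
       \<mu>2 (\<delta>1 x) y + \<mu>2 x (\<delta>1 y) + \<mu>1 (\<delta>2 x) y + \<mu>1 x (\<delta>2 y)"

end

theory Submission
  imports Defs
begin

text \<open>
  The right-hand side of the zinbiel identity is symmetric in \<open>x\<close> and \<open>y\<close>, so left multiplications
  commute: \<open>x * (y * z) = y * (x * z)\<close>. Both sides of associativity for the symmetrized product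
  therefore expand to \<open>x * (y * z) + z * (x * y) + z * (y * x)\<close>. The compatibility identity is the
  polarization of the zinbiel identity, and the same computation applies to
  \<open>P x y z = x *\<^sub>1 (y *\<^sub>2 z) + x *\<^sub>2 (y *\<^sub>1 z)\<close>, which is symmetric in its first two arguments.
\<close>

lemma bilinear_op_add_left:
  assumes "bilinear_op scale m"
  shows "m (x + y) z = m x z + m y z"
  using assms Vector_Spaces.linear.axioms(3)[THEN module_hom.add] unfolding bilinear_op_def by blast

lemma bilinear_op_add_right:
  assumes "bilinear_op scale m"
  shows "m x (y + z) = m x y + m x z"
  using assms Vector_Spaces.linear.axioms(3)[THEN module_hom.add] unfolding bilinear_op_def by blast

text \<open>Swapping the arguments exchanges the two clauses of \<open>bilinear_op\<close>, and a
  sum of linear maps is linear.\<close>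

lemma bilinear_op_symmetrize:
  assumes "vector_space scale" and "bilinear_op scale m"
  shows "bilinear_op scale (\<lambda>x y. m x y + m y x)"
proof -
  interpret vector_space_pair scale scale
    using assms(1) by (simp add: vector_space_pair_def)
  show ?thesis
    using assms(2) by (simp add: bilinear_op_def linear_compose_add)
qed

lemma derivation_add:
  "derivation scale m d \<Longrightarrow> d (x + y) = d x + d y"
  using Vector_Spaces.linear.axioms(3)[THEN module_hom.add] unfolding derivation_def by blast

text \<open>A derivation of \<open>m\<close> is also one of the opposite product, hence of the sum
  of the two.\<close>

lemma derivation_symmetrize:
  assumes "derivation scale m d"
  shows "derivation scale (\<lambda>x y. m x y + m y x) d"
  using assms derivation_add[OF assms] by (simp add: derivation_def algebra_simps)

lemma (in zinbiel_algebra) left_mult_commute: "ast x (ast y z) = ast y (ast x z)"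
  by (simp add: zinbiel add.commute)

lemma (in zinbiel_algebra) assoc_algebra_symmetrize:
  "assoc_algebra scale (\<lambda>x y. ast x y + ast y x)"
proof unfold_locales
  show "bilinear_op scale (\<lambda>x y. ast x y + ast y x)"
    using vector_space_axioms bilinear by (rule bilinear_op_symmetrize)
next
  fix x y z
  note [simp] = bilinear_op_add_left[OF bilinear] bilinear_op_add_right[OF bilinear]
  show "ast (ast x y + ast y x) z + ast z (ast x y + ast y x) =
      ast x (ast y z + ast z y) + ast (ast y z + ast z y) x"
    \<comment> \<open>The zinbiel instances absorb the products with \<open>z\<close>, respectively
      \<open>x\<close>, as right factor. The commutations then match \<open>x * (z * y)\<close> with
      \<open>z * (x * y)\<close> and \<open>y * (z * x)\<close> with
      \<open>z * (y * x)\<close>.\<close>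
    using zinbiel[of x y z] zinbiel[of y z x]
      left_mult_commute[of x z y] left_mult_commute[of y z x]
    by (simp add: algebra_simps)
qed

lemma (in zinDer_pair) AssDer_pair_symmetrize:
  "AssDer_pair scale (\<lambda>x y. ast x y + ast y x) \<delta>"
  using assoc_algebra_symmetrize derivation_symmetrize[OF derivation]
  by (simp add: AssDer_pair_def AssDer_pair_axioms_def)

lemma (in compatible_zinDer_pair) polarized_left_mult_commute:
  "ast1 x (ast2 y z) + ast2 x (ast1 y z) = ast1 y (ast2 x z) + ast2 y (ast1 x z)"
  by (simp add: zinbiel_compat algebra_simps)

lemma (in compatible_zinDer_pair) compatible_AssDer_pair_symmetrize:
  "compatible_AssDer_pair scale
     (\<lambda>x y. ast1 x y + ast1 y x) (\<lambda>x y. ast2 x y + ast2 y x) \<delta>1 \<delta>2"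
proof (intro compatible_AssDer_pair.intro compatible_AssDer_pair_axioms.intro)
  note [simp] = bilinear_op_add_left[OF Z1.bilinear] bilinear_op_add_right[OF Z1.bilinear]
    bilinear_op_add_left[OF Z2.bilinear] bilinear_op_add_right[OF Z2.bilinear]
    derivation_add[OF Z1.derivation] derivation_add[OF Z2.derivation]
  show "AssDer_pair scale (\<lambda>x y. ast1 x y + ast1 y x) \<delta>1"
    by (rule Z1.AssDer_pair_symmetrize)
  show "AssDer_pair scale (\<lambda>x y. ast2 x y + ast2 y x) \<delta>2"
    by (rule Z2.AssDer_pair_symmetrize)
  fix x y z
  \<comment> \<open>\<open>?P\<close> and \<open>?Q\<close> are the two sides of
    \<open>zinbiel_compat\<close>.\<close>
  let ?P = "\<lambda>x y z. ast1 x (ast2 y z) + ast2 x (ast1 y z)"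
  let ?Q = "\<lambda>x y z. ast1 (ast2 x y) z + ast2 (ast1 x y) z +
    ast1 (ast2 y x) z + ast2 (ast1 y x) z"
  have "ast2 (ast1 x y + ast1 y x) z + ast2 z (ast1 x y + ast1 y x) +
      (ast1 (ast2 x y + ast2 y x) z + ast1 z (ast2 x y + ast2 y x)) =
      ?Q x y z + ?P z x y + ?P z y x"
    by (simp add: algebra_simps)
  \<comment> \<open>Every \<open>?Q\<close> becomes \<open>?P\<close>. Fixing the first argument to
    \<open>z\<close> directs the symmetry of \<open>?P\<close>: \<open>?P z x y\<close> turns into
    \<open>?P x z y\<close>, and \<open>?P z y x\<close> into \<open>?P y z x\<close>, which is
    \<open>?Q y z x\<close>.\<close>
  also have "\<dots> = ?P x y z + ?P x z y + ?Q y z x"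
    by (simp only: zinbiel_compat[symmetric] polarized_left_mult_commute[of z])
  also have "\<dots> = ast1 x (ast2 y z + ast2 z y) + ast1 (ast2 y z + ast2 z y) x +
      (ast2 x (ast1 y z + ast1 z y) + ast2 (ast1 y z + ast1 z y) x)"
    by (simp add: algebra_simps)
  finally show "ast2 (ast1 x y + ast1 y x) z + ast2 z (ast1 x y + ast1 y x) +
      (ast1 (ast2 x y + ast2 y x) z + ast1 z (ast2 x y + ast2 y x)) =
      ast1 x (ast2 y z + ast2 z y) + ast1 (ast2 y z + ast2 z y) x +
      (ast2 x (ast1 y z + ast1 z y) + ast2 (ast1 y z + ast1 z y) x)" .
  show "\<delta>1 (ast2 x y + ast2 y x) + \<delta>2 (ast1 x y + ast1 y x) =
      ast2 (\<delta>1 x) y + ast2 y (\<delta>1 x) + (ast2 x (\<delta>1 y) + ast2 (\<delta>1 y) x) +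
      (ast1 (\<delta>2 x) y + ast1 y (\<delta>2 x)) + (ast1 x (\<delta>2 y) + ast1 (\<delta>2 y) x)"
    \<comment> \<open>The sum of the mixed product rules for \<open>(x, y)\<close> and
      \<open>(y, x)\<close> is the symmetrized rule.\<close>
    using arg_cong2[where f = "(+)", OF derivation_compat[of x y] derivation_compat[of y x]]
    by (simp add: algebra_simps)
qed

theorem proposition4p12:
  fixes scale :: "'k::field_char_0 \<Rightarrow> 'v::ab_group_add \<Rightarrow> 'v"
    and ast1 ast2 :: "'v \<Rightarrow> 'v \<Rightarrow> 'v"
    and \<delta>1 \<delta>2 :: "'v \<Rightarrow> 'v"
  assumes "compatible_zinDer_pair scale ast1 ast2 \<delta>1 \<delta>2"
  shows "compatible_AssDer_pair scale
           (\<lambda>x y. ast1 x y + ast1 y x) (\<lambda>x y. ast2 x y + ast2 y x) \<delta>1 \<delta>2"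
  using assms by (rule compatible_zinDer_pair.compatible_AssDer_pair_symmetrize)

end
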